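(* Let $\psi$ be a homomorphism and $B$ any stochastic inverse of $\psi$. Let $|Q^*(h,a)-Q^*(h',a')|\le\varepsilon$ for all $\psi(h,a)=\psi(h',a')$. Then for all $h\in\mathcal H$, $a\in\mathcal A$ and $(s,b)=\psi(h,a)$: (i) $|Q^*(h,a)-q^*(s,b)|\le\frac{2\varepsilon}{1-\gamma}$ and $|V^*(h)-v^*(s)|\le\frac{2\varepsilon}{1-\gamma}$. (ii) $0\le V^*(h)-V^{\breve\Pi}(h)\le\frac{4\varepsilon}{(1-\gamma)^2}$, where $\breve\Pi$ is a deterministic policy with $\breve\Pi(h)\in\psi_s^{-1}(\pi^*(s))$ for any $h$ with $\psi(h)=s$, and $\pi^*:\mathcal S\to\mathcal B$ is a deterministic optimal abstract policy of the surrogate MDP $p_B$.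
   Context: Setting. $\mathcal A$ (actions), $\mathcal O$ (observations), $\mathcal R\subseteq[0,1]$ (rewards) are finite sets; $\gamma\in[0,1)$; $\Delta(X)$ is the set of probability distributions on $X$. $\mathcal H:=\bigcup_{t\ge0}(\mathcal A\times\mathcal O\times\mathcal R)^t$ is the set of histories. The original process is a map $P:\mathcal H\times\mathcal A\to\Delta(\mathcal O\times\mathcal R)$, written $P(or|ha)$ (arbitrary dependence on the history). A policy is a map $\Pi:\mathcal H\to\Delta(\mathcal A)$. Its (action-)value functions are given by $Q^\Pi(h,a)=\sum_{o,r}P(or|ha)\,(r+\gamma V^\Pi(haor))$ and $V^\Pi(h)=\sum_{a}Q^\Pi(h,a)\Pi(a|h)$, where $haor$ is the history $h$ extended by $(a,o,r)$. $Q^*,V^*$ are the (action-)value functions of an optimal policy $\Pi^*$ (one maximizing $V^\Pi$); thus $V^*(h)=\max_aQ^*(h,a)$. Homomorphism. $\mathcal S$ and $\mathcal B$ are finite sets (abstract states and abstract actions). A homomorphism is a surjective map $\psi:\mathcal H\times\mathcal A\to\mathcal S\times\mathcal B$ whose state component depends only on the history: $\psi(h,a)=(f(h),b)$ for a fixed surjective $f:\mathcal H\to\mathcal S$ (while $b$ may depend on both $h$ and $a$). Write $\psi(h)=s$ for $f(h)=s$, and, for $f(h)=s$, $\psi_s^{-1}(b):=\{a\in\mathcal A:\psi(h,a)=(s,b)\}$ (it depends on $h$). The induced abstract process is $P_\psi(s'r|ha):=\sum_{o:\psi(haor)=s'}P(or|ha)$. No Markov assumption on $P_\psi$ is made. Surrogate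 MDP. A stochastic inverse of $\psi$ is a map $B:\mathcal S\times\mathcal B\to\Delta(\mathcal H\times\mathcal A)$, written $B(ha|sb)$, with $B(ha|sb)=0$ whenever $\psi(h,a)\ne(s,b)$. It defines the MDP $p_B(s'r'|sb):=\sum_{h\in\mathcal H,a\in\mathcal A}P_\psi(s'r'|ha)B(ha|sb)$. For an abstract policy $\pi:\mathcal S\to\Delta(\mathcal B)$, $q^\pi,v^\pi$ are given by $q^\pi(s,b)=\sum_{s',r}p_B(s'r|sb)(r+\gamma v^\pi(s'))$, $v^\pi(s)=\sum_bq^\pi(s,b)\pi(b|s)$. An abstract policy is optimal if it maximizes $v^\pi$; $q^*,v^*$ are the (action-)value functions of an optimal abstract policy.
   Formalization: Part (i) is also proved under the assumption, made in the English only in (ii), that a deterministic optimal π* and a policy Π̆ with Π̆(h)∈ψ_s^{-1}(π*(s)) for all h exist; without it (i) fails, since ψ_s^{-1}(π*(s)) may be empty at some histories. *)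

theory Defs
  imports "HOL-Probability.Probability"
begin

text \<open>
  Actions, observations, abstract states and abstract actions are finite types.  The finite
  reward set is the range of an injection \<open>rew\<close> from a finite type \<open>'r\<close> into the unit
  interval, so that a history is just a list.  The most recent step is the last list element.
\<close>

type_synonym ('a, 'o, 'r) hist = "('a \<times> 'o \<times> 'r) list"

type_synonym ('a, 'o, 'r) process = "('a, 'o, 'r) hist \<Rightarrow> 'a \<Rightarrow> ('o \<times> 'r) pmf"

type_synonym ('a, 'o, 'r) policy = "('a, 'o, 'r) hist \<Rightarrow> 'a pmf"

type_synonym ('s, 'b, 'r) mdp = "'s \<Rightarrow> 'b \<Rightarrow> ('s \<times> 'r) pmf"

definition reward_map :: "('r::finite \<Rightarrow> real) \<Rightarrow> bool" where
  "reward_map rew \<longleftrightarrow> inj rew \<and> range rew \<subseteq> {0..1}"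


section \<open>Value functions of the original process\<close>

definition backup :: "('a, 'o::finite, 'r::finite) process \<Rightarrow> ('r \<Rightarrow> real) \<Rightarrow> real
    \<Rightarrow> (('a, 'o, 'r) hist \<Rightarrow> real) \<Rightarrow> ('a, 'o, 'r) hist \<Rightarrow> 'a \<Rightarrow> real" where
  "backup P rew \<gamma> V h a =
     (\<Sum>(ob, r)\<in>UNIV. pmf (P h a) (ob, r) * (rew r + \<gamma> * V (h @ [(a, ob, r)])))"

text \<open>
  The Bellman equations alone also have unbounded solutions, because there are infinitely many
  histories; the value function is the unique bounded one (lemma \<open>ex1_V\<close> below).
\<close>

definition is_V :: "('a::finite, 'o::finite, 'r::finite) process \<Rightarrow> ('r \<Rightarrow> real) \<Rightarrow> real
    \<Rightarrow> ('a, 'o, 'r) policy \<Rightarrow> (('a, 'o, 'r) hist \<Rightarrow> real) \<Rightarrow> bool" where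
  "is_V P rew \<gamma> pol V \<longleftrightarrow> bounded (range V) \<and>
     (\<forall>h. V h = (\<Sum>a\<in>UNIV. backup P rew \<gamma> V h a * pmf (pol h) a))"

definition V_val :: "('a::finite, 'o::finite, 'r::finite) process \<Rightarrow> ('r \<Rightarrow> real) \<Rightarrow> real
    \<Rightarrow> ('a, 'o, 'r) policy \<Rightarrow> ('a, 'o, 'r) hist \<Rightarrow> real" where
  "V_val P rew \<gamma> pol = (THE V. is_V P rew \<gamma> pol V)"

definition Q_val :: "('a::finite, 'o::finite, 'r::finite) process \<Rightarrow> ('r \<Rightarrow> real) \<Rightarrow> real
    \<Rightarrow> ('a, 'o, 'r) policy \<Rightarrow> ('a, 'o, 'r) hist \<Rightarrow> 'a \<Rightarrow> real" where
  "Q_val P rew \<gamma> pol h a = backup P rew \<gamma> (V_val P rew \<gamma> pol) h a"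

definition optimal_policy :: "('a::finite, 'o::finite, 'r::finite) process \<Rightarrow> ('r \<Rightarrow> real) \<Rightarrow> real
    \<Rightarrow> ('a, 'o, 'r) policy \<Rightarrow> bool" where
  "optimal_policy P rew \<gamma> pol \<longleftrightarrow> (\<forall>pol' h. V_val P rew \<gamma> pol' h \<le> V_val P rew \<gamma> pol h)"


section \<open>Value functions of a finite MDP\<close>

definition mdp_backup :: "('s::finite, 'b, 'r::finite) mdp \<Rightarrow> ('r \<Rightarrow> real) \<Rightarrow> real
    \<Rightarrow> ('s \<Rightarrow> real) \<Rightarrow> 's \<Rightarrow> 'b \<Rightarrow> real" where
  "mdp_backup p rew \<gamma> v s b = (\<Sum>(s', r)\<in>UNIV. pmf (p s b) (s', r) * (rew r + \<gamma> * v s'))"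

definition is_v :: "('s::finite, 'b::finite, 'r::finite) mdp \<Rightarrow> ('r \<Rightarrow> real) \<Rightarrow> real
    \<Rightarrow> ('s \<Rightarrow> 'b pmf) \<Rightarrow> ('s \<Rightarrow> real) \<Rightarrow> bool" where
  "is_v p rew \<gamma> \<pi> v \<longleftrightarrow> (\<forall>s. v s = (\<Sum>b\<in>UNIV. mdp_backup p rew \<gamma> v s b * pmf (\<pi> s) b))"

definition v_val :: "('s::finite, 'b::finite, 'r::finite) mdp \<Rightarrow> ('r \<Rightarrow> real) \<Rightarrow> real
    \<Rightarrow> ('s \<Rightarrow> 'b pmf) \<Rightarrow> 's \<Rightarrow> real" where
  "v_val p rew \<gamma> \<pi> = (THE v. is_v p rew \<gamma> \<pi> v)"

definition q_val :: "('s::finite, 'b::finite, 'r::finite) mdp \<Rightarrow> ('r \<Rightarrow> real) \<Rightarrow> real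
    \<Rightarrow> ('s \<Rightarrow> 'b pmf) \<Rightarrow> 's \<Rightarrow> 'b \<Rightarrow> real" where
  "q_val p rew \<gamma> \<pi> s b = mdp_backup p rew \<gamma> (v_val p rew \<gamma> \<pi>) s b"

definition mdp_optimal_policy :: "('s::finite, 'b::finite, 'r::finite) mdp \<Rightarrow> ('r \<Rightarrow> real) \<Rightarrow> real
    \<Rightarrow> ('s \<Rightarrow> 'b pmf) \<Rightarrow> bool" where
  "mdp_optimal_policy p rew \<gamma> \<pi> \<longleftrightarrow> (\<forall>\<pi>' s. v_val p rew \<gamma> \<pi>' s \<le> v_val p rew \<gamma> \<pi> s)"


section \<open>Homomorphisms and the surrogate MDP\<close>

definition homomorphism :: "(('a, 'o, 'r) hist \<times> 'a \<Rightarrow> 's \<times> 'b)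
    \<Rightarrow> (('a, 'o, 'r) hist \<Rightarrow> 's) \<Rightarrow> bool" where
  "homomorphism \<psi> f \<longleftrightarrow> surj \<psi> \<and> surj f \<and> (\<forall>h a. fst (\<psi> (h, a)) = f h)"

text \<open>\<open>\<psi>\<^sub>s\<^sup>-\<^sup>1(b)\<close>, which also depends on the history.  It may be empty.\<close>

definition action_preimage :: "(('a, 'o, 'r) hist \<times> 'a \<Rightarrow> 's \<times> 'b)
    \<Rightarrow> ('a, 'o, 'r) hist \<Rightarrow> 's \<Rightarrow> 'b \<Rightarrow> 'a set" where
  "action_preimage \<psi> h s b = {a. \<psi> (h, a) = (s, b)}"

definition abstract_process :: "('a, 'o, 'r) process \<Rightarrow> (('a, 'o, 'r) hist \<Rightarrow> 's)
    \<Rightarrow> ('a, 'o, 'r) hist \<Rightarrow> 'a \<Rightarrow> ('s \<times> 'r) pmf" where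
  "abstract_process P f h a = map_pmf (\<lambda>(ob, r). (f (h @ [(a, ob, r)]), r)) (P h a)"

definition stochastic_inverse :: "(('a, 'o, 'r) hist \<times> 'a \<Rightarrow> 's \<times> 'b)
    \<Rightarrow> ('s \<Rightarrow> 'b \<Rightarrow> (('a, 'o, 'r) hist \<times> 'a) pmf) \<Rightarrow> bool" where
  "stochastic_inverse \<psi> B \<longleftrightarrow>
     (\<forall>s b h a. \<psi> (h, a) \<noteq> (s, b) \<longrightarrow> pmf (B s b) (h, a) = 0)"

definition surrogate_mdp :: "('a, 'o, 'r) process \<Rightarrow> (('a, 'o, 'r) hist \<Rightarrow> 's)
    \<Rightarrow> ('s \<Rightarrow> 'b \<Rightarrow> (('a, 'o, 'r) hist \<times> 'a) pmf) \<Rightarrow> ('s, 'b, 'r) mdp" where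
  "surrogate_mdp P f B s b = bind_pmf (B s b) (\<lambda>(h, a). abstract_process P f h a)"

lemma pmf_abstract_process:
  fixes P :: "('a, 'o::finite, 'r::finite) process"
  shows "pmf (abstract_process P f h a) (s', r) =
    (\<Sum>ob | f (h @ [(a, ob, r)]) = s'. pmf (P h a) (ob, r))"
proof -
  have "(\<lambda>(ob, r). (f (h @ [(a, ob, r)]), r)) -` {(s', r)} =
      (\<lambda>ob. (ob, r)) ` {ob. f (h @ [(a, ob, r)]) = s'}"
    by auto
  then show ?thesis
    unfolding abstract_process_def pmf_map
    by (simp add: measure_measure_pmf_finite sum.reindex inj_on_def)
qed

lemma pmf_surrogate_mdp:
  "pmf (surrogate_mdp P f B s b) (s', r) =
    (\<Sum>\<^sub>\<infinity>(h, a)\<in>UNIV. pmf (abstract_process P f h a) (s', r) * pmf (B s b) (h, a))"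
proof -
  let ?g = "\<lambda>x. pmf (B s b) x * pmf (abstract_process P f (fst x) (snd x)) (s', r)"
  have "Infinite_Set_Sum.abs_summable_on ?g UNIV"
    by (rule abs_summable_on_comparison_test[OF pmf_abs_summable[of "B s b" UNIV]])
       (auto simp: abs_mult intro!: mult_right_le_one_le pmf_le_1)
  have "pmf (surrogate_mdp P f B s b) (s', r) = infsetsum ?g UNIV"
    unfolding surrogate_mdp_def pmf_bind
    by (simp add: pmf_expectation_eq_infsetsum case_prod_unfold)
  also have "\<dots> = infsum ?g UNIV"
    using \<open>Infinite_Set_Sum.abs_summable_on ?g UNIV\<close> by (rule infsetsum_infsum)
  finally show ?thesis
    by (simp add: case_prod_unfold mult.commute)
qed


section \<open>The value functions are well defined\<close>

lemma ex1_bounded_fixpoint: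
  fixes T :: "('x \<Rightarrow> real) \<Rightarrow> 'x \<Rightarrow> real"
  assumes \<gamma>: "0 \<le> \<gamma>" "\<gamma> < 1"
    and zero: "bounded (range (T (\<lambda>_. 0)))"
    and contr: "\<And>v w M x. (\<And>y. \<bar>v y - w y\<bar> \<le> M) \<Longrightarrow> \<bar>T v x - T w x\<bar> \<le> \<gamma> * M"
  shows "\<exists>!v. bounded (range v) \<and> (\<forall>x. v x = T v x)"
proof -
  have bdd: "bounded (range (T v))" if v: "bounded (range v)" for v
  proof -
    obtain M where M: "\<And>y. \<bar>v y\<bar> \<le> M" using v unfolding bounded_iff by auto
    obtain C where C: "\<And>y. \<bar>T (\<lambda>_. 0) y\<bar> \<le> C" using zero unfolding bounded_iff by auto
    have "\<bar>T v x\<bar> \<le> C + \<gamma> * M" for x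
      using contr[of v "\<lambda>_. 0" M x] M C[of x] by force
    then show ?thesis unfolding bounded_iff by auto
  qed
  define F :: "('x discrete \<Rightarrow>\<^sub>C real) \<Rightarrow> ('x discrete \<Rightarrow>\<^sub>C real)" where
    "F g = Bcontfun (\<lambda>x. T (\<lambda>y. g (discrete y)) (of_discrete x))" for g
  have range_bc: "(\<lambda>x. v (of_discrete x)) \<in> bcontfun" if "bounded (range v)" for v :: "'x \<Rightarrow> real"
    using that unfolding bcontfun_def
    by (auto simp: continuous_on_open_invariant open_discrete intro: bounded_subset)
  have g_bdd: "bounded (range (\<lambda>y. apply_bcontfun g (discrete y)))" for g :: "'x discrete \<Rightarrow>\<^sub>C real"
    using bounded_apply_bcontfun by (rule bounded_subset) auto
  have F: "F g x = T (\<lambda>y. g (discrete y)) (of_discrete x)" for g x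
    unfolding F_def using range_bc[OF bdd[OF g_bdd[of g]]] by (simp add: Bcontfun_inverse)
  have "\<exists>!g. F g = g"
  proof (rule banach_fix_type[OF \<gamma>])
    show "\<forall>g h. dist (F g) (F h) \<le> \<gamma> * dist g h"
    proof (intro allI dist_bound)
      fix g h x
      show "dist (F g x) (F h x) \<le> \<gamma> * dist g h"
        unfolding F dist_real_def
        by (rule contr) (metis dist_bounded dist_real_def)
    qed
  qed
  then obtain g where g: "F g = g" and uniq: "\<And>g'. F g' = g' \<Longrightarrow> g' = g" by blast
  show ?thesis
  proof (rule ex1I[of _ "\<lambda>y. g (discrete y)"])
    show "bounded (range (\<lambda>y. g (discrete y))) \<and>
        (\<forall>x. g (discrete x) = T (\<lambda>y. g (discrete y)) x)"
      using g_bdd[of g] F[of g "discrete _"] g by (metis discrete_inverse UNIV_I)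
  next
    fix v assume v: "bounded (range v) \<and> (\<forall>x. v x = T v x)"
    define g' where "g' = Bcontfun (\<lambda>x. v (of_discrete x))"
    have g': "g' x = v (of_discrete x)" for x
      unfolding g'_def using Bcontfun_inverse[OF range_bc[of v]] v by metis
    have "F g' = g'"
      by (rule bcontfun_eqI) (simp only: F g' discrete_inverse UNIV_I conjunct2[OF v, rule_format, symmetric])
    then have "g' = g" by (rule uniq)
    then show "v = (\<lambda>y. g (discrete y))"
      using g' by (metis discrete_inverse UNIV_I)
  qed
qed

lemma avg_diff_le:
  fixes p :: "'x::finite pmf"
  assumes "\<And>x. \<bar>v x - w x\<bar> \<le> M"
  shows "\<bar>(\<Sum>x\<in>UNIV. pmf p x * v x) - (\<Sum>x\<in>UNIV. pmf p x * w x)\<bar> \<le> M"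
proof -
  have "\<bar>\<Sum>x\<in>UNIV. pmf p x * (v x - w x)\<bar> \<le> (\<Sum>x\<in>UNIV. pmf p x * M)"
    by (rule order.trans[OF sum_abs sum_mono]) (simp add: abs_mult assms mult_left_mono)
  also have "\<dots> = M"
    by (simp add: sum_distrib_right[symmetric] sum_pmf_eq_1)
  finally show ?thesis
    by (simp add: right_diff_distrib sum_subtractf)
qed

lemma ex1_V:
  fixes P :: "('a::finite, 'o::finite, 'r::finite) process"
  assumes \<gamma>: "0 \<le> \<gamma>" "\<gamma> < 1" and rew: "reward_map rew"
  shows "\<exists>!V. is_V P rew \<gamma> pol V"
  unfolding is_V_def
proof (rule ex1_bounded_fixpoint[OF \<gamma>])
  have r: "\<bar>rew r\<bar> \<le> 1" for r using rew unfolding reward_map_def by (auto simp: image_subset_iff)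
  have "\<bar>backup P rew \<gamma> (\<lambda>_. 0) h a\<bar> \<le> 1" for h a
    using avg_diff_le[of "\<lambda>(ob, r). rew r" "\<lambda>_. 0" 1 "P h a"] r
    by (simp add: backup_def case_prod_unfold)
  then have "\<bar>\<Sum>a\<in>UNIV. backup P rew \<gamma> (\<lambda>_. 0) h a * pmf (pol h) a\<bar> \<le> 1" for h
    using avg_diff_le[of "backup P rew \<gamma> (\<lambda>_. 0) h" "\<lambda>_. 0" 1 "pol h"] by (simp add: mult.commute)
  then show "bounded (range (\<lambda>h. \<Sum>a\<in>UNIV. backup P rew \<gamma> (\<lambda>_. 0) h a * pmf (pol h) a))"
    unfolding bounded_iff by auto
next
  fix V W :: "('a, 'o, 'r) hist \<Rightarrow> real" and M h
  assume VW: "\<And>y. \<bar>V y - W y\<bar> \<le> M"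
  have "\<bar>backup P rew \<gamma> V h a - backup P rew \<gamma> W h a\<bar> \<le> \<gamma> * M" for a
    using avg_diff_le[of "\<lambda>(ob, r). rew r + \<gamma> * V (h @ [(a, ob, r)])"
        "\<lambda>(ob, r). rew r + \<gamma> * W (h @ [(a, ob, r)])" "\<gamma> * M" "P h a"] VW \<gamma>
    by (simp add: backup_def case_prod_unfold right_diff_distrib[symmetric] abs_mult mult_left_mono)
  then show "\<bar>(\<Sum>a\<in>UNIV. backup P rew \<gamma> V h a * pmf (pol h) a) -
      (\<Sum>a\<in>UNIV. backup P rew \<gamma> W h a * pmf (pol h) a)\<bar> \<le> \<gamma> * M"
    using avg_diff_le[of "backup P rew \<gamma> V h" "backup P rew \<gamma> W h" "\<gamma> * M" "pol h"]
    by (simp add: mult.commute)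
qed

lemma ex1_v:
  assumes \<gamma>: "0 \<le> \<gamma>" "\<gamma> < 1"
  shows "\<exists>!v. is_v p rew \<gamma> \<pi> v"
proof -
  have fin: "bounded (range (v :: 'a \<Rightarrow> real))" for v by (simp add: finite_imp_bounded)
  have "\<exists>!v. bounded (range v) \<and>
      (\<forall>s. v s = (\<Sum>b\<in>UNIV. mdp_backup p rew \<gamma> v s b * pmf (\<pi> s) b))"
  proof (rule ex1_bounded_fixpoint[OF \<gamma> fin])
    fix v w :: "'a \<Rightarrow> real" and M s
    assume vw: "\<And>y. \<bar>v y - w y\<bar> \<le> M"
    have "\<bar>mdp_backup p rew \<gamma> v s b - mdp_backup p rew \<gamma> w s b\<bar> \<le> \<gamma> * M" for b
      using avg_diff_le[of "\<lambda>(s', r). rew r + \<gamma> * v s'" "\<lambda>(s', r). rew r + \<gamma> * w s'"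
          "\<gamma> * M" "p s b"] vw \<gamma>
      by (simp add: mdp_backup_def case_prod_unfold right_diff_distrib[symmetric] abs_mult
          mult_left_mono)
    then show "\<bar>(\<Sum>b\<in>UNIV. mdp_backup p rew \<gamma> v s b * pmf (\<pi> s) b) -
        (\<Sum>b\<in>UNIV. mdp_backup p rew \<gamma> w s b * pmf (\<pi> s) b)\<bar> \<le> \<gamma> * M"
      using avg_diff_le[of "mdp_backup p rew \<gamma> v s" "mdp_backup p rew \<gamma> w s" "\<gamma> * M" "\<pi> s"]
      by (simp add: mult.commute)
  qed
  then show ?thesis using fin by (simp add: is_v_def)
qed

end

theory Submission
  imports Defs
begin

text \<open>
  Abstracting histories and actions: \<open>q\<^sup>*(s,b)\<close> is the \<open>B(\<cdot>|sb)\<close>-average of one-step backups of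
  \<open>v\<^sup>* \<circ> f\<close> over pairs in the class \<open>(s,b)\<close>, whereas the values \<open>Q\<^sup>*\<close> on this class differ by at
  most \<open>\<epsilon>\<close>.  So a bound \<open>M\<close> on \<open>|V\<^sup>* - v\<^sup>* \<circ> f|\<close> gives the bound \<open>\<epsilon> + \<gamma> M\<close> on
  \<open>|Q\<^sup>* - q\<^sup>* \<circ> \<psi>|\<close>, and hence on \<open>|V\<^sup>* - v\<^sup>* \<circ> f|\<close>; therefore both are at most \<open>\<epsilon> / (1 - \<gamma>)\<close>.
  Not every abstract action need be available at a history, but \<open>\<pi>\<^sup>*(s)\<close> is, which suffices
  to compare the maxima.  The lifted policy then loses at most \<open>2 \<epsilon> / (1 - \<gamma>)\<close> in
  each step.
\<close>

text \<open>Take the supremum of \<open>g\<close> as \<open>M\<close>: it is finite by boundedness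
  and satisfies \<open>?M \<le> c + \<gamma> * ?M\<close>, which can be solved because
  \<open>\<gamma> < 1\<close>. Every fixed-point comparison below ends this way.\<close>

lemma self_bounding_le:
  fixes g :: "'x \<Rightarrow> real"
  assumes "bdd_above (range g)" "\<gamma> < 1"
    and step: "\<And>M x. (\<And>y. g y \<le> M) \<Longrightarrow> g x \<le> c + \<gamma> * M"
  shows "g x \<le> c / (1 - \<gamma>)"
proof -
  let ?M = "SUP y. g y"
  have le: "g y \<le> ?M" for y using assms(1) by (rule cSUP_upper[OF UNIV_I])
  have "?M \<le> c + \<gamma> * ?M" by (rule cSUP_least) (use step[OF le] in auto)
  then have "?M \<le> c / (1 - \<gamma>)" using \<open>\<gamma> < 1\<close> by (simp add: field_simps)
  then show ?thesis using le order.trans by blast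
qed

lemma sum_pmf_le:
  fixes p :: "'x::finite pmf"
  assumes "\<And>x. u x \<le> M"
  shows "(\<Sum>x\<in>UNIV. pmf p x * u x) \<le> (M::real)"
proof -
  have "(\<Sum>x\<in>UNIV. pmf p x * u x) \<le> (\<Sum>x\<in>UNIV. pmf p x * M)"
    by (intro sum_mono mult_left_mono assms) simp
  then show ?thesis by (simp add: sum_distrib_right[symmetric] sum_pmf_eq_1)
qed

lemma sum_pmf_diff_le:
  fixes p :: "'x::finite pmf"
  assumes "\<And>x. u x - w x \<le> M"
  shows "(\<Sum>x\<in>UNIV. pmf p x * u x) - (\<Sum>x\<in>UNIV. pmf p x * w x) \<le> (M::real)"
  using sum_pmf_le[of "\<lambda>x. u x - w x" M p] assms by (simp add: right_diff_distrib sum_subtractf)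

lemma sum_return_pmf:
  fixes u :: "'x::finite \<Rightarrow> real"
  shows "(\<Sum>x\<in>UNIV. u x * pmf (return_pmf y) x) = u y"
  by (simp add: indicator_def if_distrib sum.delta cong: if_cong)

text \<open>The rewards cancel, leaving \<gamma> times an average of \<open>V - W\<close>. The
  one-sided form suits loss estimates; used in both directions it gives the absolute bound.\<close>

lemma backup_diff_le:
  fixes P :: "('a, 'o::finite, 'r::finite) process"
  assumes "0 \<le> \<gamma>" "\<And>h. V h - W h \<le> M"
  shows "backup P rew \<gamma> V h a - backup P rew \<gamma> W h a \<le> \<gamma> * M"
  using sum_pmf_diff_le[of "\<lambda>(ob, r). rew r + \<gamma> * V (h @ [(a, ob, r)])"
      "\<lambda>(ob, r). rew r + \<gamma> * W (h @ [(a, ob, r)])" "\<gamma> * M" "P h a"] assms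
  by (simp add: backup_def case_prod_unfold mult_left_mono flip: right_diff_distrib)

lemma mdp_backup_diff_le:
  fixes p :: "('s::finite, 'b, 'r::finite) mdp"
  assumes "0 \<le> \<gamma>" "\<And>s. v s - w s \<le> M"
  shows "mdp_backup p rew \<gamma> v s b - mdp_backup p rew \<gamma> w s b \<le> \<gamma> * M"
  using sum_pmf_diff_le[of "\<lambda>(s', r). rew r + \<gamma> * v s'" "\<lambda>(s', r). rew r + \<gamma> * w s'"
      "\<gamma> * M" "p s b"] assms
  by (simp add: mdp_backup_def case_prod_unfold mult_left_mono flip: right_diff_distrib)

lemma is_V_V_val:
  fixes P :: "('a::finite, 'o::finite, 'r::finite) process"
  assumes "0 \<le> \<gamma>" "\<gamma> < 1" "reward_map rew"
  shows "is_V P rew \<gamma> pol (V_val P rew \<gamma> pol)"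
  unfolding V_val_def by (rule theI'[OF ex1_V[OF assms]])

lemma is_v_v_val:
  assumes "0 \<le> \<gamma>" "\<gamma> < 1"
  shows "is_v p rew \<gamma> \<pi> (v_val p rew \<gamma> \<pi>)"
  unfolding v_val_def by (rule theI'[OF ex1_v[OF assms]])

text \<open>Policy improvement: the policy that is greedy for \<open>v\<close> has a value of at least \<open>max\<^sub>a Q v x a\<close>.\<close>

lemma optimal_value_ge_backup:
  fixes Q :: "('x \<Rightarrow> real) \<Rightarrow> 'x \<Rightarrow> 'a::finite \<Rightarrow> real"
  assumes "0 \<le> \<gamma>" "\<gamma> < 1"
    and diff: "\<And>v w M x a. (\<And>y. v y - w y \<le> M) \<Longrightarrow> Q v x a - Q w x a \<le> \<gamma> * M"
    and v: "bounded (range v)" "\<And>x. v x = (\<Sum>a\<in>UNIV. Q v x a * pmf (pol x) a)"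
    and opt: "\<And>pol'. \<exists>w. bounded (range w) \<and> (\<forall>x. w x = (\<Sum>a\<in>UNIV. Q w x a * pmf (pol' x) a)) \<and>
      (\<forall>x. w x \<le> v x)"
  shows "Q v x a \<le> v x"
proof -
  have "\<exists>a. \<forall>a'. Q v x a' \<le> Q v x a" for x
    using Max_in[of "range (Q v x)"] Max_ge[of "range (Q v x)"] by fastforce
  then obtain g where g: "\<And>x a. Q v x a \<le> Q v x (g x)" by metis
  \<comment> \<open>\<open>w\<close> is the value of the deterministic greedy policy
    \<open>g\<close>; optimality of \<open>v\<close> puts it below \<open>v\<close>.\<close>
  obtain w where w: "bounded (range w)" "\<And>x. w x = Q w x (g x)" and wv: "\<And>x. w x \<le> v x"
    using opt[of "\<lambda>x. return_pmf (g x)"] unfolding sum_return_pmf by blast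
  have v_le: "v x \<le> Q v x (g x)" for x
    using sum_pmf_le[of "Q v x" "Q v x (g x)" "pol x"] g v(2)[of x] by (simp add: mult.commute)
  \<comment> \<open>Conversely \<open>v \<le> w\<close>: subtracting
    \<open>w x = Q w x (g x)\<close> from \<open>v_le\<close> improves any bound \<open>M\<close> on
    \<open>v - w\<close> to \<open>\<gamma> * M\<close>, so the self-bounding argument applies with
    \<open>c = 0\<close>.\<close>
  have "bounded (range (\<lambda>x. v x - w x))" by (intro bounded_minus_comp v w)
  then have "v x - w x \<le> 0 / (1 - \<gamma>)" for x
  proof (rule self_bounding_le[OF bounded_imp_bdd_above \<open>\<gamma> < 1\<close>])
    fix M x assume "\<And>y. v y - w y \<le> M"
    from diff[of v w M x "g x", OF this] v_le[of x] w(2)[of x]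
    show "v x - w x \<le> 0 + \<gamma> * M" by simp
  qed
  then have "\<And>x. v x - w x \<le> 0" by simp
  \<comment> \<open>The chain is
    \<open>Q v x a \<le> Q v x (g x) \<le> Q w x (g x) = w x \<le> v x\<close>; its second link is
    \<open>diff\<close> with \<open>M = 0\<close>.\<close>
  from diff[of v w 0 x "g x", OF this] g[of x a] w(2)[of x] wv[of x] show ?thesis by simp
qed

text \<open>Optimality is defined by comparing policies only. This is the half of the Bellman
  optimality equation that needs policy improvement; the other half is averaging over
  actions.\<close>

lemma Q_val_le_V_val:
  fixes P :: "('a::finite, 'o::finite, 'r::finite) process"
  assumes "0 \<le> \<gamma>" "\<gamma> < 1" "reward_map rew" "optimal_policy P rew \<gamma> pol"
  shows "Q_val P rew \<gamma> pol h a \<le> V_val P rew \<gamma> pol h"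
  unfolding Q_val_def
proof (rule optimal_value_ge_backup[of \<gamma> "backup P rew \<gamma>" "V_val P rew \<gamma> pol" pol])
  fix pol'
  show "\<exists>w. bounded (range w) \<and> (\<forall>h. w h = (\<Sum>a\<in>UNIV. backup P rew \<gamma> w h a * pmf (pol' h) a)) \<and>
      (\<forall>h. w h \<le> V_val P rew \<gamma> pol h)"
    using is_V_V_val[OF assms(1-3), of P pol'] assms(4)
    unfolding is_V_def optimal_policy_def by (intro exI[of _ "V_val P rew \<gamma> pol'"] conjI) fast+
next
  show "backup P rew \<gamma> V h a - backup P rew \<gamma> W h a \<le> \<gamma> * M"
    if "\<And>h. V h - W h \<le> M" for V W M h a
    using \<open>0 \<le> \<gamma>\<close> that by (rule backup_diff_le)
qed (use assms is_V_V_val[OF assms(1-3), of P pol] in \<open>simp_all only: is_V_def\<close>)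

lemma q_val_le_v_val:
  assumes "0 \<le> \<gamma>" "\<gamma> < 1" "mdp_optimal_policy p rew \<gamma> \<pi>"
  shows "q_val p rew \<gamma> \<pi> s b \<le> v_val p rew \<gamma> \<pi> s"
  unfolding q_val_def
proof (rule optimal_value_ge_backup[of \<gamma> "mdp_backup p rew \<gamma>" "v_val p rew \<gamma> \<pi>" \<pi>])
  fix \<pi>'
  show "\<exists>w. bounded (range w) \<and> (\<forall>s. w s = (\<Sum>b\<in>UNIV. mdp_backup p rew \<gamma> w s b * pmf (\<pi>' s) b)) \<and>
      (\<forall>s. w s \<le> v_val p rew \<gamma> \<pi> s)"
    using is_v_v_val[OF assms(1,2), of p rew \<pi>'] assms(3)
    unfolding is_v_def mdp_optimal_policy_def
    by (intro exI[of _ "v_val p rew \<gamma> \<pi>'"] conjI finite_imp_bounded finite_imageI finite) fast+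
next
  show "mdp_backup p rew \<gamma> v s b - mdp_backup p rew \<gamma> w s b \<le> \<gamma> * M"
    if "\<And>s. v s - w s \<le> M" for v w M s b
    using \<open>0 \<le> \<gamma>\<close> that by (rule mdp_backup_diff_le)
  show "bounded (range (v_val p rew \<gamma> \<pi>))" by (simp add: finite_imp_bounded)
qed (use assms is_v_v_val[OF assms(1,2), of p rew \<pi>] in \<open>simp_all only: is_v_def\<close>)

lemma expectation_dist_le:
  fixes g :: "'x \<Rightarrow> real"
  assumes "\<And>x. x \<in> set_pmf p \<Longrightarrow> \<bar>g x - c\<bar> \<le> K"
  shows "\<bar>measure_pmf.expectation p g - c\<bar> \<le> K"
proof -
  \<comment> \<open>The support may be infinite, so integrability is a real obligation; on the
    support \<open>g\<close> is bounded by \<open>\<bar>c\<bar> + K\<close>.\<close>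
  have "integrable (measure_pmf p) g"
    by (rule measure_pmf.integrable_const_bound[where B = "\<bar>c\<bar> + K"])
      (use assms in \<open>force simp: AE_measure_pmf_iff\<close>)+
  then have "measure_pmf.expectation p g \<le> c + K" "c - K \<le> measure_pmf.expectation p g"
    by (auto intro!: measure_pmf.integral_le_const measure_pmf.integral_ge_const
        simp: AE_measure_pmf_iff dest!: assms)
  then show ?thesis by linarith
qed

text \<open>The surrogate kernel is a \<open>B\<close>-mixture of images of \<open>P\<close> under
  \<open>f\<close>. Iterated expectation handles the mixture, and a change of variables turns
  \<open>v\<close> at the next abstract state into \<open>v\<close> composed with \<open>f\<close>
  at the next history.\<close>

lemma mdp_backup_surrogate_mdp:
  fixes P :: "('a::finite, 'o::finite, 'r::finite) process"
  shows "mdp_backup (surrogate_mdp P f B) rew \<gamma> v s b =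
    measure_pmf.expectation (B s b) (\<lambda>(h, a). backup P rew \<gamma> (\<lambda>h. v (f h)) h a)"
proof -
  let ?u = "\<lambda>(s', r). rew r + \<gamma> * v s'"
  \<comment> \<open>This maximum over a finite type is the uniform bound that
    \<open>integral_bind\<close> asks for.\<close>
  have u: "\<And>x. \<bar>?u x\<bar> \<le> Max (range (\<lambda>x. \<bar>?u x\<bar>))" by (rule Max_ge) auto
  have "mdp_backup (surrogate_mdp P f B) rew \<gamma> v s b =
      measure_pmf.expectation (surrogate_mdp P f B s b) ?u"
    by (subst integral_measure_pmf_real[of UNIV])
      (simp_all add: mdp_backup_def case_prod_unfold mult.commute)
  also have "\<dots> = measure_pmf.expectation (B s b)
      (\<lambda>x. measure_pmf.expectation (abstract_process P f (fst x) (snd x)) ?u)"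
    unfolding surrogate_mdp_def measure_pmf_bind case_prod_unfold
    by (subst integral_bind[where K = "count_space UNIV" and B' = 1 and B = "Max (range (\<lambda>x. \<bar>?u x\<bar>))"])
      (use u in \<open>auto simp: measure_pmf.emeasure_space_1 case_prod_unfold space_subprob_algebra measure_pmf.subprob_space_axioms\<close>)
  also have "(\<lambda>x. measure_pmf.expectation (abstract_process P f (fst x) (snd x)) ?u) =
      (\<lambda>(h, a). backup P rew \<gamma> (\<lambda>h. v (f h)) h a)"
    unfolding abstract_process_def integral_map_pmf case_prod_unfold
    by (subst integral_measure_pmf_real[of UNIV])
      (simp_all add: backup_def case_prod_unfold mult.commute)
  finally show ?thesis .
qed

theorem theorem8:
  fixes P :: "('a::finite, 'o::finite, 'r::finite) process"
    and rew :: "'r \<Rightarrow> real"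
    and \<gamma> \<epsilon> :: real
    and \<psi> :: "('a, 'o, 'r) hist \<times> 'a \<Rightarrow> 's::finite \<times> 'b::finite"
    and f :: "('a, 'o, 'r) hist \<Rightarrow> 's"
    and B :: "'s \<Rightarrow> 'b \<Rightarrow> (('a, 'o, 'r) hist \<times> 'a) pmf"
    and pol_opt :: "('a, 'o, 'r) policy"
    and apol_opt :: "'s \<Rightarrow> 'b pmf"
    and apol_det :: "'s \<Rightarrow> 'b"
    and pol_breve :: "('a, 'o, 'r) hist \<Rightarrow> 'a"
  defines "Qstar \<equiv> Q_val P rew \<gamma> pol_opt"
    and "Vstar \<equiv> V_val P rew \<gamma> pol_opt"
    and "qstar \<equiv> q_val (surrogate_mdp P f B) rew \<gamma> apol_opt"
    and "vstar \<equiv> v_val (surrogate_mdp P f B) rew \<gamma> apol_opt"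
  assumes "reward_map rew"
    and "0 \<le> \<gamma>" and "\<gamma> < 1"
    and "homomorphism \<psi> f"
    and "stochastic_inverse \<psi> B"
    and "optimal_policy P rew \<gamma> pol_opt"
    and "mdp_optimal_policy (surrogate_mdp P f B) rew \<gamma> apol_opt"
    and "\<And>h a h' a'. \<psi> (h, a) = \<psi> (h', a') \<Longrightarrow> \<bar>Qstar h a - Qstar h' a'\<bar> \<le> \<epsilon>"
    and "mdp_optimal_policy (surrogate_mdp P f B) rew \<gamma> (\<lambda>s. return_pmf (apol_det s))"
    and "\<And>h s. f h = s \<Longrightarrow> pol_breve h \<in> action_preimage \<psi> h s (apol_det s)"
  shows "\<forall>h a s b. (s, b) = \<psi> (h, a) \<longrightarrow>
      (\<bar>Qstar h a - qstar s b\<bar> \<le> 2 * \<epsilon> / (1 - \<gamma>) \<and>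
       \<bar>Vstar h - vstar s\<bar> \<le> 2 * \<epsilon> / (1 - \<gamma>)) \<and>
      (0 \<le> Vstar h - V_val P rew \<gamma> (\<lambda>h. return_pmf (pol_breve h)) h \<and>
       Vstar h - V_val P rew \<gamma> (\<lambda>h. return_pmf (pol_breve h)) h \<le> 4 * \<epsilon> / (1 - \<gamma>)\<^sup>2)"
proof -
  let ?p = "surrogate_mdp P f B" and ?K = "\<epsilon> / (1 - \<gamma>)"
  note \<gamma> = \<open>0 \<le> \<gamma>\<close> \<open>\<gamma> < 1\<close> and rew = \<open>reward_map rew\<close>
  note opt = \<open>optimal_policy P rew \<gamma> pol_opt\<close>
  have f: "fst (\<psi> (h, a)) = f h" for h a
    using \<open>homomorphism \<psi> f\<close> by (simp add: homomorphism_def)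
  \<comment> \<open>Compare a pair with itself.\<close>
  have "0 \<le> \<epsilon>" using assms(12)[OF refl] by force
  then have K: "0 \<le> ?K" using \<gamma> by simp
  have Vstar: "bounded (range Vstar)" "Vstar h = (\<Sum>a\<in>UNIV. pmf (pol_opt h) a * Qstar h a)" for h
    using is_V_V_val[OF \<gamma> rew, of P pol_opt]
    by (auto simp only: is_V_def Vstar_def Qstar_def Q_val_def mult.commute)
  have Q_le: "Qstar h a \<le> Vstar h" for h a
    unfolding Qstar_def Vstar_def by (rule Q_val_le_V_val[OF \<gamma> rew opt])
  have q_le: "qstar s b \<le> vstar s" for s b
    unfolding qstar_def vstar_def
    by (rule q_val_le_v_val[OF \<gamma>]) fact
  \<comment> \<open>Two optimal policies dominate each other, hence share their value function. The
    Bellman equation of the deterministic one then expresses \<open>vstar\<close> through the single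
    action \<open>apol_det s\<close>.\<close>
  have "v_val ?p rew \<gamma> (\<lambda>s. return_pmf (apol_det s)) = vstar"
    using assms(11,13) unfolding mdp_optimal_policy_def vstar_def by (blast intro: ext antisym)
  then have "vstar s = mdp_backup ?p rew \<gamma> vstar s (apol_det s)" for s
    using is_v_v_val[OF \<gamma>, of ?p rew "\<lambda>s. return_pmf (apol_det s)"]
    by (simp only: is_v_def sum_return_pmf)
  then have v_det: "vstar s = qstar s (apol_det s)" for s
    by (simp add: qstar_def vstar_def q_val_def)
  have \<psi>_breve: "\<psi> (h, pol_breve h) = (f h, apol_det (f h))" for h
    using assms(14)[OF refl, of h] by (simp add: action_preimage_def)

  \<comment> \<open>The directions are asymmetric. For \<open>V_le\<close>, every concrete action
    has an abstract image, whose \<open>qstar\<close> is at most \<open>vstar\<close>. For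
    \<open>V_ge\<close>, only the abstract action attaining \<open>vstar\<close> has to be realised
    at \<open>h\<close>, and \<open>pol_breve h\<close> does so.\<close>
  have V_le: "Vstar h - vstar (f h) \<le> L"
    and V_ge: "vstar (f h) - Vstar h \<le> L"
    if *: "\<And>a s b. \<psi> (h, a) = (s, b) \<Longrightarrow> \<bar>Qstar h a - qstar s b\<bar> \<le> L" for h L
  proof -
    have "Qstar h a \<le> vstar (f h) + L" for a
      using *[of a "f h" "snd (\<psi> (h, a))"] q_le[of "f h" "snd (\<psi> (h, a))"] f[of h a]
      by (force simp: prod_eq_iff)
    then show "Vstar h - vstar (f h) \<le> L"
      using sum_pmf_le[of "Qstar h" "vstar (f h) + L" "pol_opt h"] Vstar(2)[of h] by simp
    show "vstar (f h) - Vstar h \<le> L"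
      using *[OF \<psi>_breve] Q_le[of h "pol_breve h"] v_det[of "f h"] by linarith
  qed

  \<comment> \<open>Each pair in the support of \<open>B s b\<close> lies in the class of
    \<open>(h, a)\<close>. Moving between the two pairs costs \<epsilon>; replacing
    \<open>Vstar\<close> by \<open>vstar\<close> after one step costs
    \<open>\<gamma> * M\<close>.\<close>
  have Qq: "\<bar>Qstar h a - qstar s b\<bar> \<le> \<epsilon> + \<gamma> * M"
    if M: "\<And>h. \<bar>Vstar h - vstar (f h)\<bar> \<le> M" and hab: "\<psi> (h, a) = (s, b)" for M h a s b
  proof -
    have "\<bar>measure_pmf.expectation (B s b) (\<lambda>(h, a). backup P rew \<gamma> (\<lambda>h. vstar (f h)) h a) -
        Qstar h a\<bar> \<le> \<epsilon> + \<gamma> * M"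
    proof (rule expectation_dist_le, clarify)
      fix h' a' assume "(h', a') \<in> set_pmf (B s b)"
      then have "\<psi> (h', a') = \<psi> (h, a)"
        using \<open>stochastic_inverse \<psi> B\<close> hab unfolding stochastic_inverse_def set_pmf_iff by metis
      then have "\<bar>Qstar h' a' - Qstar h a\<bar> \<le> \<epsilon>" by (rule assms(12))
      moreover have "Vstar h - vstar (f h) \<le> M" "vstar (f h) - Vstar h \<le> M" for h
        using M[of h] by linarith+
      then have "\<bar>backup P rew \<gamma> (\<lambda>h. vstar (f h)) h' a' - Qstar h' a'\<bar> \<le> \<gamma> * M"
        using backup_diff_le[OF \<open>0 \<le> \<gamma>\<close>, of Vstar "\<lambda>h. vstar (f h)" M P rew h' a']
          backup_diff_le[OF \<open>0 \<le> \<gamma>\<close>, of "\<lambda>h. vstar (f h)" Vstar M P rew h' a']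
        unfolding Qstar_def Q_val_def Vstar_def[symmetric] abs_le_iff by simp
      ultimately show "\<bar>backup P rew \<gamma> (\<lambda>h. vstar (f h)) h' a' - Qstar h a\<bar> \<le> \<epsilon> + \<gamma> * M"
        by linarith
    qed
    then show ?thesis
      by (simp add: qstar_def q_val_def vstar_def mdp_backup_surrogate_mdp abs_minus_commute)
  qed

  have "bounded (range (\<lambda>h. Vstar h - vstar (f h)))"
    by (rule bounded_minus_comp[OF Vstar(1)])
      (rule bounded_subset[of "range vstar"], auto intro: finite_imp_bounded)
  then have bdd: "bdd_above (range (\<lambda>h. \<bar>Vstar h - vstar (f h)\<bar>))"
    by (force simp: bounded_iff bdd_above_def)
  have Vv: "\<bar>Vstar h - vstar (f h)\<bar> \<le> ?K" for h
  proof (rule self_bounding_le[OF bdd \<open>\<gamma> < 1\<close>])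
    fix M h assume "\<And>h. \<bar>Vstar h - vstar (f h)\<bar> \<le> M"
    from V_le[OF Qq[OF this]] V_ge[OF Qq[OF this]]
    show "\<bar>Vstar h - vstar (f h)\<bar> \<le> \<epsilon> + \<gamma> * M" by (simp add: abs_le_iff)
  qed
  \<comment> \<open>\<open>?K\<close> is the fixed point of the map taking \<open>M\<close> to
    \<open>\<epsilon> + \<gamma> * M\<close>, so feeding \<open>Vv\<close> back into
    \<open>Qq\<close> yields the same constant.\<close>
  have "\<epsilon> + \<gamma> * ?K = ?K" using \<gamma> by (simp add: field_simps)
  then have Qq_K: "\<bar>Qstar h a - qstar s b\<bar> \<le> ?K" if "\<psi> (h, a) = (s, b)" for h a s b
    using Qq[OF Vv that] by simp

  define W where "W = V_val P rew \<gamma> (\<lambda>h. return_pmf (pol_breve h))"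
  have W: "bounded (range W)" "W h = backup P rew \<gamma> W h (pol_breve h)" for h
    using is_V_V_val[OF \<gamma> rew, of P "\<lambda>h. return_pmf (pol_breve h)"]
    unfolding is_V_def sum_return_pmf W_def[symmetric] by blast+
  \<comment> \<open>One \<open>?K\<close> pays for passing from \<open>Vstar\<close> to
    \<open>vstar\<close>, the other for passing from \<open>qstar\<close> at \<open>apol_det\<close>
    back to \<open>Qstar\<close> at \<open>pol_breve h\<close>.\<close>
  have loss: "Vstar h \<le> Qstar h (pol_breve h) + 2 * ?K" for h
    using Vv[of h] Qq_K[OF \<psi>_breve, of h] v_det[of "f h"] by linarith
  have "bounded (range (\<lambda>h. Vstar h - W h))" by (intro bounded_minus_comp Vstar W)
  then have VW: "Vstar h - W h \<le> 2 * ?K / (1 - \<gamma>)" for h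
  proof (rule self_bounding_le[OF bounded_imp_bdd_above \<open>\<gamma> < 1\<close>])
    fix M h assume "\<And>h. Vstar h - W h \<le> M"
    \<comment> \<open>Split at the first action: choosing \<open>pol_breve h\<close> loses at most
      \<open>2 * ?K\<close>, and continuing with \<open>W\<close> instead of \<open>Vstar\<close>
      loses at most \<open>\<gamma> * M\<close>.\<close>
    from backup_diff_le[of \<gamma> Vstar W M P rew h "pol_breve h", OF \<open>0 \<le> \<gamma>\<close> this] loss[of h] W(2)[of h]
    show "Vstar h - W h \<le> 2 * ?K + \<gamma> * M"
      unfolding Qstar_def Q_val_def Vstar_def[symmetric] by linarith
  qed
  \<comment> \<open>The bounds obtained are half of those claimed; nonnegativity of \<epsilon>
    permits doubling them.\<close>
  have K2: "?K \<le> 2 * \<epsilon> / (1 - \<gamma>)" using K by simp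
  have "2 * ?K / (1 - \<gamma>) \<le> 4 * \<epsilon> / (1 - \<gamma>)\<^sup>2"
    using \<open>0 \<le> \<epsilon>\<close> by (simp add: power2_eq_square divide_right_mono)
  moreover have "W h \<le> Vstar h" for h
    using opt by (simp add: optimal_policy_def W_def Vstar_def)
  ultimately show ?thesis
    unfolding W_def[symmetric]
  proof (intro allI impI conjI)
    fix h a s b assume hab: "(s, b) = \<psi> (h, a)"
    then have s: "s = f h" using f[of h a] by (metis fst_conv)
    show "\<bar>Qstar h a - qstar s b\<bar> \<le> 2 * \<epsilon> / (1 - \<gamma>)"
      using Qq_K[OF hab[symmetric]] K2 by (rule order.trans)
    show "\<bar>Vstar h - vstar s\<bar> \<le> 2 * \<epsilon> / (1 - \<gamma>)"
      unfolding s using Vv K2 by (rule order.trans)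
  qed (use VW in \<open>auto intro: order.trans\<close>)
qed

end
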